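(* Let $\|\cdot\|_X$ be a norm on $\mathbb{R}^2$ such that its unit ball $BX$ is a polygon with finitely many sides and all (Euclidean) angles between its sides are rational multiples of $\pi$. Then there is a well-distributed set $S\subset X$ such that $$|\Delta_{X,N}(S)|=O(N)\quad(N\to\infty).$$
   Context: $X$ denotes $\mathbb{R}^2$ equipped with the norm $\|\cdot\|_X$, and $BX=\{x:\|x\|_X\le 1\}$. A set $S\subset X$ is well-distributed if there is a constant $K$ such that for every $x\in X$ there is $y\in S$ with $\|x-y\|_X\le K$. For a positive integer $N$ and $A\subset X$, $\Delta_{X,N}(A)$ is the set of all numbers $\|a-a'\|_X$ with $a,a'\in A$ and $\|a-a'\|_X\le N$; $|\cdot|$ denotes cardinality, and $N$ runs over positive integers. *)

theory Defs
  imports "HOL-Analysis.Analysis" "HOL-Library.Landau_Symbols"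
begin

text \<open>
  The type \<^typ>\<open>real^2\<close> carries the Euclidean norm as its class operation
  \<^term>\<open>norm\<close>; an arbitrary second norm is represented by a function.
\<close>

definition is_norm :: "('a::real_vector \<Rightarrow> real) \<Rightarrow> bool" where
  "is_norm nX \<longleftrightarrow>
     (\<forall>x. nX x \<ge> 0) \<and>
     (\<forall>x. nX x = 0 \<longleftrightarrow> x = 0) \<and>
     (\<forall>c x. nX (c *\<^sub>R x) = \<bar>c\<bar> * nX x) \<and>
     (\<forall>x y. nX (x + y) \<le> nX x + nX y)"

definition norm_unit_ball :: "('a \<Rightarrow> real) \<Rightarrow> 'a set" where
  "norm_unit_ball nX = {x. nX x \<le> 1}"

text \<open>
  Only convex polygons are needed, since the unit ball of a norm is convex. A polytope has finitely
  many faces by definition; the dimension condition excludes points and segments.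
\<close>

definition convex_polygon :: "(real^2) set \<Rightarrow> bool" where
  "convex_polygon P \<longleftrightarrow> polytope P \<and> aff_dim P = 2"

definition euclidean_angle :: "'a::real_inner \<Rightarrow> 'a \<Rightarrow> real" where
  "euclidean_angle u v = arccos ((u \<bullet> v) / (norm u * norm v))"

text \<open>
  The sides of a polygon are its one-dimensional faces. The angle between two sides is taken
  between direction vectors. Reversing a direction replaces the angle \<open>\<theta>\<close> by \<open>\<pi> - \<theta>\<close>, so
  rationality does not depend on the orientations, and the condition may quantify over all
  orientations.
\<close>

definition rational_side_angles :: "(real^2) set \<Rightarrow> bool" where
  "rational_side_angles P \<longleftrightarrow>
     (\<forall>a b c d. closed_segment a b edge_of P \<longrightarrow> closed_segment c d edge_of P \<longrightarrow>
        (\<exists>q\<in>\<rat>. euclidean_angle (b - a) (d - c) = q * pi))"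

definition well_distributed :: "('a::ab_group_add \<Rightarrow> real) \<Rightarrow> 'a set \<Rightarrow> bool" where
  "well_distributed nX S \<longleftrightarrow> (\<exists>K. \<forall>x. \<exists>y\<in>S. nX (x - y) \<le> K)"

definition distance_set :: "('a::ab_group_add \<Rightarrow> real) \<Rightarrow> nat \<Rightarrow> 'a set \<Rightarrow> real set" where
  "distance_set nX N A = {nX (a - a') | a a'. a \<in> A \<and> a' \<in> A \<and> nX (a - a') \<le> real N}"

end

theory Submission
  imports Defs
begin

text \<open>
  Identify the plane with the complex numbers so that one side of the polygon is parallel to the
  real axis. For a suitable \<open>m\<close> every side is then parallel to an \<open>m\<close>-th root of unity, and on each
  of the finitely many sectors the norm of \<open>w\<close> is a constant multiple of a height
  \<open>Im (w \<omega>\<^sup>-\<^sup>l)\<close>, where \<open>\<omega> = exp (2 \<pi> i / m)\<close>. The set \<open>S\<close> is a cut-and-project set: it consists of the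
  \<open>\<Sum>j. x\<^sub>j \<omega>\<^sup>j\<close> with integers \<open>x\<^sub>j\<close> such that \<open>\<Sum>j. x\<^sub>j \<omega>\<^sup>j\<^sup>k\<close> is bounded for all \<open>k\<close> other than \<open>\<plusminus>1\<close> mod \<open>m\<close>.
  Rounding the inverse discrete Fourier transform shows that \<open>S\<close> is relatively dense. A bounded
  height of a difference of points of \<open>S\<close> comes from an integer sequence whose whole transform is
  bounded, so there are only finitely many such heights, and a height set whose differences are
  locally finite has \<open>O(N)\<close> elements up to \<open>N\<close>.
\<close>

section \<open>Discrete Fourier transform of periodic integer sequences\<close>

definition unity :: "int \<Rightarrow> int \<Rightarrow> complex" where
  "unity m k = cis (2 * pi * of_int k / of_int m)"

definition periodic :: "int \<Rightarrow> (int \<Rightarrow> 'a) \<Rightarrow> bool" where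
  "periodic m x \<longleftrightarrow> (\<forall>j. x (j mod m) = x j)"

text \<open>Unnormalised; the sign of the exponent makes frequency \<open>1\<close> the point of the
  plane attached to the sequence.\<close>

definition dft :: "int \<Rightarrow> (int \<Rightarrow> int) \<Rightarrow> int \<Rightarrow> complex" where
  "dft m x k = (\<Sum>j\<in>{0..<m}. of_int (x j) * unity m (j * k))"

lemma unity_add: "unity m (j + k) = unity m j * unity m k"
  by (simp add: unity_def cis_mult add_divide_distrib distrib_left)

lemma unity_diff: "unity m (j - k) = unity m j * unity m (- k)"
  using unity_add[of m j "- k"] by simp

lemma norm_unity [simp]: "norm (unity m k) = 1"
  by (simp add: unity_def)

lemma cnj_unity: "cnj (unity m k) = unity m (- k)"
  by (simp add: unity_def cis_cnj)

lemma unity_mult_self: "m > 0 \<Longrightarrow> unity m (m * k) = 1"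
  using cis_multiple_2pi[of "of_int k"] by (simp add: unity_def mult.assoc)

lemma unity_mod: "m > 0 \<Longrightarrow> unity m (j mod m * k) = unity m (j * k)"
proof -
  assume m: "m > 0"
  have "j * k = m * (j div m * k) + j mod m * k"
    by (metis mult.assoc div_mult_mod_eq distrib_right mult.commute)
  then show ?thesis
    using m by (simp add: unity_add unity_mult_self)
qed

lemma unity_eq_1_iff:
  assumes "m > 0"
  shows "unity m k = 1 \<longleftrightarrow> m dvd k"
proof
  assume "unity m k = 1"
  then have "cos (2 * pi * of_int k / of_int m) = 1"
    by (metis unity_def cis.sel(1) one_complex.sel(1))
  then obtain n :: int where "2 * pi * of_int k / of_int m = of_int n * 2 * pi"
    by (auto simp: cos_one_2pi_int)
  then have "of_int k = (of_int (n * m) :: real)"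
    using assms by (simp add: field_simps)
  then show "m dvd k" by (metis dvd_triv_right of_int_eq_iff)
qed (use assms in \<open>auto simp: unity_mult_self\<close>)

section \<open>Sums over one period\<close>

lemma periodic_shift: "periodic m x \<Longrightarrow> periodic m (\<lambda>j. x (j + l))"
  unfolding periodic_def by (metis mod_add_left_eq)

lemma periodic_reflect: "periodic m x \<Longrightarrow> periodic m (\<lambda>j. x (l - j))"
  unfolding periodic_def by (metis mod_diff_right_eq)

lemma sum_periodic_shift:
  fixes h :: "int \<Rightarrow> 'a::comm_monoid_add"
  assumes "periodic m h" "m > 0"
  shows "(\<Sum>j\<in>{0..<m}. h (j + l)) = (\<Sum>j\<in>{0..<m}. h j)"
proof (rule sum.reindex_bij_witness[of _ "\<lambda>j. (j - l) mod m" "\<lambda>j. (j + l) mod m"])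
  show "h ((j + l) mod m) = h (j + l)" for j
    using assms by (simp add: periodic_def)
qed (use assms in \<open>auto simp: mod_simps\<close>)

lemma sum_periodic_reflect:
  fixes h :: "int \<Rightarrow> 'a::comm_monoid_add"
  assumes "periodic m h" "m > 0"
  shows "(\<Sum>j\<in>{0..<m}. h (l - j)) = (\<Sum>j\<in>{0..<m}. h j)"
proof (rule sum.reindex_bij_witness[of _ "\<lambda>j. (l - j) mod m" "\<lambda>j. (l - j) mod m"])
  show "h ((l - j) mod m) = h (l - j)" for j
    using assms by (simp add: periodic_def)
qed (use assms in \<open>auto simp: mod_simps\<close>)

text \<open>Shifting the index by one multiplies the sum by \<open>unity m k\<close>, so the sum
  vanishes unless that factor is \<open>1\<close>.\<close>

lemma sum_unity:
  assumes "m > 0"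
  shows "(\<Sum>j\<in>{0..<m}. unity m (j * k)) = (if m dvd k then of_int m else 0)"
proof (cases "m dvd k")
  case True
  then have "unity m (j * k) = 1" for j
    using assms by (simp add: unity_eq_1_iff)
  then show ?thesis
    using True assms by simp
next
  case False
  have "periodic m (\<lambda>j. unity m (j * k))"
    using assms by (simp add: periodic_def unity_mod)
  from sum_periodic_shift[OF this assms, of 1]
  have "(\<Sum>j\<in>{0..<m}. unity m (j * k)) * unity m k = (\<Sum>j\<in>{0..<m}. unity m (j * k))"
    by (simp add: distrib_right unity_add sum_distrib_right)
  then show ?thesis
    using False assms by (simp add: unity_eq_1_iff)
qed

section \<open>Symmetries and inversion of the transform\<close>

lemma dft_diff: "dft m (\<lambda>j. x j - y j) k = dft m x k - dft m y k"
  by (simp add: dft_def sum_subtractf algebra_simps)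

lemma cnj_dft: "cnj (dft m x k) = dft m x (- k)"
  by (simp add: dft_def cnj_unity)

lemma dft_shift:
  assumes "periodic m x" "m > 0"
  shows "dft m (\<lambda>j. x (j + l)) k = dft m x k * unity m (- l * k)"
proof -
  have per: "periodic m (\<lambda>j. of_int (x j) * unity m ((j - l) * k))"
    using assms by (simp add: periodic_def left_diff_distrib unity_diff unity_mod)
  have "dft m (\<lambda>j. x (j + l)) k = (\<Sum>j\<in>{0..<m}. of_int (x j) * unity m ((j - l) * k))"
    using sum_periodic_shift[OF per assms(2), of l] by (simp add: dft_def)
  also have "\<dots> = dft m x k * unity m (- l * k)"
    by (simp add: dft_def sum_distrib_right left_diff_distrib unity_diff mult.assoc)
  finally show ?thesis .
qed

lemma dft_reflect:
  assumes "periodic m x" "m > 0"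
  shows "dft m (\<lambda>j. x (l - j)) k = dft m x (- k) * unity m (l * k)"
proof -
  have per: "periodic m (\<lambda>j. of_int (x j) * unity m ((l - j) * k))"
    using assms unity_mod[OF assms(2), of _ "-k"]
    by (simp add: periodic_def left_diff_distrib unity_diff)
  have "dft m (\<lambda>j. x (l - j)) k = (\<Sum>j\<in>{0..<m}. of_int (x j) * unity m ((l - j) * k))"
    using sum_periodic_reflect[OF per assms(2), of l] by (simp add: dft_def)
  also have "\<dots> = dft m x (- k) * unity m (l * k)"
    by (simp add: dft_def sum_distrib_right sum_distrib_left left_diff_distrib right_diff_distrib
        unity_diff mult_ac)
  finally show ?thesis .
qed

text \<open>Interchanging the sums leaves, for each \<open>j\<close>, the character sum at
  \<open>j - i\<close>, which survives only for \<open>j = i\<close>.\<close>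

lemma dft_inversion:
  assumes "0 \<le> i" "i < m"
  shows "(\<Sum>k\<in>{0..<m}. dft m x k * unity m (- i * k)) = of_int m * of_int (x i)"
proof -
  have m: "m > 0" using assms by simp
  have "(\<Sum>k\<in>{0..<m}. dft m x k * unity m (- i * k))
      = (\<Sum>k\<in>{0..<m}. \<Sum>j\<in>{0..<m}. of_int (x j) * unity m (k * (j - i)))"
    by (simp add: dft_def sum_distrib_right sum_distrib_left right_diff_distrib unity_diff mult_ac)
  also have "\<dots> = (\<Sum>j\<in>{0..<m}. of_int (x j) * (\<Sum>k\<in>{0..<m}. unity m (k * (j - i))))"
    by (subst sum.swap) (simp add: sum_distrib_left)
  also have "\<dots> = (\<Sum>j\<in>{0..<m}. if j = i then of_int (x j) * of_int m else 0)"
  proof (rule sum.cong[OF refl])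
    fix j assume "j \<in> {0..<m}"
    then have "m dvd j - i \<longleftrightarrow> j = i"
      using assms by (simp flip: mod_eq_dvd_iff)
    then show "of_int (x j) * (\<Sum>k\<in>{0..<m}. unity m (k * (j - i)))
        = (if j = i then of_int (x j) * of_int m else 0)"
      by (simp add: sum_unity[OF m])
  qed
  finally show ?thesis
    using assms by (simp add: mult.commute)
qed

text \<open>Inversion bounds every entry by \<open>B\<close>; integrality leaves finitely many
  choices on one period, and one period determines the sequence.\<close>

lemma finite_bounded_dft:
  assumes m: "m > 0"
  shows "finite {x. periodic m x \<and> (\<forall>k. norm (dft m x k) \<le> B)}" (is "finite ?A")
proof (rule finite_imageD)
  let ?res = "\<lambda>x :: int \<Rightarrow> int. restrict x {0..<m}"
  have "\<bar>x i\<bar> \<le> \<lfloor>B\<rfloor>" if x: "x \<in> ?A" and i: "i \<in> {0..<m}" for x i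
  proof -
    have "of_int m * \<bar>of_int (x i)\<bar> = norm (\<Sum>k\<in>{0..<m}. dft m x k * unity m (- i * k))"
      using dft_inversion[of i m x] i m by (simp add: norm_mult)
    also have "\<dots> \<le> (\<Sum>k\<in>{0..<m}. B)"
      by (rule sum_norm_le) (use x in \<open>auto simp: norm_mult\<close>)
    also have "\<dots> = of_int m * B" using m by simp
    finally have "of_int \<bar>x i\<bar> \<le> B" using m by simp
    then show ?thesis by (simp add: le_floor_iff)
  qed
  then have "?res ` ?A \<subseteq> (\<Pi>\<^sub>E i\<in>{0..<m}. {-\<lfloor>B\<rfloor>..\<lfloor>B\<rfloor>})"
    by (fastforce simp: abs_le_iff)
  then show "finite (?res ` ?A)"
    by (rule finite_subset) (auto intro: finite_PiE)
  show "inj_on ?res ?A"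
  proof (rule inj_onI, rule ext)
    fix x y j assume xy: "x \<in> ?A" "y \<in> ?A" "?res x = ?res y"
    have "x (j mod m) = y (j mod m)"
      using fun_cong[OF xy(3), of "j mod m"] m by simp
    then show "x j = y j"
      using xy by (simp add: periodic_def)
  qed
qed

section \<open>Sets of real numbers with locally finite differences\<close>

text \<open>Elements with the same floor differ by less than \<open>1\<close>, so subtracting one of
  them embeds them all into \<open>D\<close>. Each unit interval thus holds at most
  \<open>card D\<close> elements.\<close>

lemma card_bounded_of_finite_differences:
  fixes V :: "real set"
  defines "D \<equiv> {v - v' | v v'. v \<in> V \<and> v' \<in> V \<and> \<bar>v - v'\<bar> \<le> 1}"
  assumes fin: "finite D" and L: "L \<ge> 0"
  shows "finite {v \<in> V. \<bar>v\<bar> \<le> L}" (is ?fin)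
    and "real (card {v \<in> V. \<bar>v\<bar> \<le> L}) \<le> real (card D) * (2 * L + 2)" (is ?card)
proof -
  define I where "I n = {v \<in> V. \<lfloor>v\<rfloor> = n}" for n :: int
  have I: "finite (I n) \<and> card (I n) \<le> card D" for n
  proof (cases "I n = {}")
    case False
    then obtain v0 where v0: "v0 \<in> I n" by blast
    have sub: "(\<lambda>v. v - v0) ` I n \<subseteq> D"
    proof (rule image_subsetI)
      fix v assume "v \<in> I n"
      then have "v \<in> V" "v0 \<in> V" "\<bar>v - v0\<bar> \<le> 1"
        using v0 by (auto simp: I_def) linarith
      then show "v - v0 \<in> D" unfolding D_def by blast
    qed
    have inj: "inj_on (\<lambda>v. v - v0) (I n)" by (auto simp: inj_on_def)
    show ?thesis
      using inj_on_finite[OF inj sub fin] card_inj_on_le[OF inj sub fin] by simp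
  qed simp
  let ?J = "{\<lfloor>- L\<rfloor>..\<lfloor>L\<rfloor>}"
  have sub: "{v \<in> V. \<bar>v\<bar> \<le> L} \<subseteq> (\<Union>n\<in>?J. I n)"
  proof
    fix v assume "v \<in> {v \<in> V. \<bar>v\<bar> \<le> L}"
    then have "v \<in> V" "- L \<le> v" "v \<le> L" by auto
    then have "v \<in> I \<lfloor>v\<rfloor>" "\<lfloor>v\<rfloor> \<in> ?J" by (auto simp: I_def intro: floor_mono)
    then show "v \<in> (\<Union>n\<in>?J. I n)" by blast
  qed
  have finU: "finite (\<Union>n\<in>?J. I n)" using I by blast
  then show ?fin using sub by (rule rev_finite_subset)
  have "card {v \<in> V. \<bar>v\<bar> \<le> L} \<le> card (\<Union>n\<in>?J. I n)"
    using finU sub by (rule card_mono)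
  also have "\<dots> \<le> (\<Sum>n\<in>?J. card (I n))" by (rule card_UN_le) simp
  also have "\<dots> \<le> (\<Sum>n\<in>?J. card D)" using I by (intro sum_mono) blast
  finally have "real (card {v \<in> V. \<bar>v\<bar> \<le> L}) \<le> real (card D) * real (card ?J)"
    by (metis mult.commute of_nat_id of_nat_le_iff of_nat_mult sum_constant)
  \<comment> \<open>The count is the floor of \<open>L\<close> plus the ceiling of \<open>L\<close>
    plus one.\<close>
  also have "real (card ?J) \<le> 2 * L + 2"
    using L by simp linarith
  finally show ?card by (simp add: mult_left_mono)
qed

section \<open>The cut-and-project set\<close>

text \<open>Frequency \<open>-1\<close> is exempt together with \<open>1\<close>, its value being
  the conjugate. The bound is a parameter because taking differences adds the bounds.\<close>

definition cap_seqs :: "int \<Rightarrow> real \<Rightarrow> (int \<Rightarrow> int) set" where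
  "cap_seqs m B = {x. periodic m x \<and>
     (\<forall>k. \<not> m dvd k - 1 \<longrightarrow> \<not> m dvd k + 1 \<longrightarrow> norm (dft m x k) \<le> B)}"

text \<open>The bound \<open>of_int m\<close> leaves room for the total error of rounding
  \<open>m\<close> entries.\<close>

definition cap_set :: "int \<Rightarrow> complex set" where
  "cap_set m = (\<lambda>x. dft m x 1) ` cap_seqs m (of_int m)"

lemma cap_seqs_diff:
  assumes "x \<in> cap_seqs m B" "y \<in> cap_seqs m C"
  shows "(\<lambda>j. x j - y j) \<in> cap_seqs m (B + C)"
proof -
  have "norm (dft m (\<lambda>j. x j - y j) k) \<le> B + C" if "\<not> m dvd k - 1" "\<not> m dvd k + 1" for k
    unfolding dft_diff using assms that
    by (intro order_trans[OF norm_triangle_ineq4] add_mono) (simp_all add: cap_seqs_def)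
  then show ?thesis
    using assms by (simp add: cap_seqs_def periodic_def)
qed

section \<open>Heights of differences\<close>

lemma dft_cong:
  assumes "m dvd k - k'" "m > 0"
  shows "dft m x k = dft m x k'"
proof -
  have "unity m (j * k) = unity m (j * k')" for j
  proof -
    obtain d where "k - k' = m * d" using assms by (elim dvdE)
    then have "j * k = m * (j * d) + j * k'" by (simp add: algebra_simps)
    then show ?thesis using assms(2) by (simp add: unity_add unity_mult_self)
  qed
  then show ?thesis by (simp add: dft_def)
qed

text \<open>Only the part of \<open>x\<close> antisymmetric about the index \<open>l\<close>
  contributes to the height. Its transform is controlled by \<open>h\<close> at the frequencies
  \<open>1\<close> and \<open>-1\<close> and by membership in \<open>cap_seqs\<close> at all others,
  so finitely many such parts occur.\<close>

lemma finite_height_values: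
  assumes m: "m > 0"
  shows "finite {h. \<exists>x\<in>cap_seqs m B. h = Im (dft m x 1 * unity m (- l)) \<and> \<bar>h\<bar> \<le> 1}"
proof -
  \<comment> \<open>\<open>2\<close> bounds the modulus of \<open>2 * \<i> * h\<close>, the value at
    \<open>1\<close>; \<open>2 * B\<close> bounds the sum of two terms at the other
    frequencies.\<close>
  let ?Y = "{y. periodic m y \<and> (\<forall>k. norm (dft m y k) \<le> max 2 (2 * B))}"
  have "{h. \<exists>x\<in>cap_seqs m B. h = Im (dft m x 1 * unity m (- l)) \<and> \<bar>h\<bar> \<le> 1}
      \<subseteq> (\<lambda>y. Im (dft m y 1) / 2) ` ?Y"
  proof (rule subsetI, elim CollectE bexE conjE)
    fix h x assume x: "x \<in> cap_seqs m B" and h: "h = Im (dft m x 1 * unity m (- l))" "\<bar>h\<bar> \<le> 1"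
    have per: "periodic m x" using x by (simp add: cap_seqs_def)
    \<comment> \<open>The odd part of the shifted sequence: its transform is twice the imaginary part of the
      transform of the shifted sequence, and it is bounded at every frequency.\<close>
    define y where "y = (\<lambda>j. x (j + l) - x (l - j))"
    have dft_y: "dft m y k = dft m x k * unity m (- l * k) - dft m x (- k) * unity m (l * k)" for k
      unfolding y_def using per m by (simp add: dft_diff dft_shift dft_reflect)
    have y1: "dft m y 1 = 2 * \<i> * of_real h"
    proof -
      have "dft m y 1 = (dft m x 1 * unity m (- l)) - cnj (dft m x 1 * unity m (- l))"
        by (simp add: dft_y cnj_dft cnj_unity)
      also have "\<dots> = of_real (2 * h) * \<i>"
        by (simp only: complex_diff_cnj h(1))
      finally show ?thesis by (simp add: mult_ac)
    qed
    have "norm (dft m y k) \<le> max 2 (2 * B)" for k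
    proof -
      consider "m dvd k - 1" | "m dvd k + 1" | "\<not> m dvd k - 1" "\<not> m dvd k + 1" by blast
      then show ?thesis
      proof cases
        case 1
        then have "dft m y k = dft m y 1" using m by (rule dft_cong)
        then show ?thesis using h(2) by (simp add: y1 norm_mult)
      next
        case 2
        then have "dft m y k = dft m y (- 1)" using m by (intro dft_cong) auto
        also have "\<dots> = cnj (dft m y 1)" by (simp add: cnj_dft)
        finally show ?thesis using h(2) by (simp add: y1 norm_mult)
      next
        case 3
        have "m dvd - k - 1 \<longleftrightarrow> m dvd k + 1" "m dvd - k + 1 \<longleftrightarrow> m dvd k - 1"
          using dvd_minus_iff[of m "k + 1"] dvd_minus_iff[of m "k - 1"] by simp_all
        then have "norm (dft m x k) \<le> B" "norm (dft m x (- k)) \<le> B"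
          using x 3 by (auto simp: cap_seqs_def)
        then have "norm (dft m y k) \<le> B + B"
          unfolding dft_y by (intro norm_triangle_le_diff add_mono) (simp_all add: norm_mult)
        then show ?thesis by simp
      qed
    qed
    moreover have "periodic m y"
      using periodic_shift[OF per, of l] periodic_reflect[OF per, of l]
      by (simp add: periodic_def y_def)
    ultimately have "y \<in> ?Y" by blast
    moreover have "h = Im (dft m y 1) / 2" by (simp add: y1)
    ultimately show "h \<in> (\<lambda>y. Im (dft m y 1) / 2) ` ?Y" by blast
  qed
  then show ?thesis
    using finite_bounded_dft[OF m] finite_surj by blast
qed

text \<open>Heights come from sequences with bound \<open>2 * m\<close>, and differences of heights
  from sequences with bound \<open>4 * m\<close>. Hence there are finitely many such differences up
  to \<open>1\<close>, and their number serves as \<open>D\<close> for every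
  \<open>L\<close>.\<close>

lemma cap_set_heights:
  assumes m: "m > 0"
  obtains D where "D \<ge> 0"
    "\<And>L. L \<ge> 0 \<Longrightarrow> finite {h. \<exists>z\<in>cap_set m. \<exists>z'\<in>cap_set m.
        h = Im ((z - z') * unity m (- l)) \<and> \<bar>h\<bar> \<le> L}"
    "\<And>L. L \<ge> 0 \<Longrightarrow> real (card {h. \<exists>z\<in>cap_set m. \<exists>z'\<in>cap_set m.
        h = Im ((z - z') * unity m (- l)) \<and> \<bar>h\<bar> \<le> L}) \<le> D * (2 * L + 2)"
proof -
  define V where "V = {h. \<exists>z\<in>cap_set m. \<exists>z'\<in>cap_set m. h = Im ((z - z') * unity m (- l))}"
  define B where "B = (of_int m + of_int m :: real)"
  have V: "\<exists>x\<in>cap_seqs m B. h = Im (dft m x 1 * unity m (- l))" if "h \<in> V" for h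
  proof -
    obtain x y where xy: "x \<in> cap_seqs m (of_int m)" "y \<in> cap_seqs m (of_int m)"
        "h = Im ((dft m x 1 - dft m y 1) * unity m (- l))"
      using \<open>h \<in> V\<close> unfolding V_def cap_set_def by blast
    then show ?thesis
      using cap_seqs_diff[OF xy(1,2)]
      by (intro bexI[of _ "\<lambda>j. x j - y j"]) (simp_all add: B_def dft_diff)
  qed
  let ?D = "{v - v' | v v'. v \<in> V \<and> v' \<in> V \<and> \<bar>v - v'\<bar> \<le> 1}"
  have "?D \<subseteq> {h. \<exists>x\<in>cap_seqs m (B + B). h = Im (dft m x 1 * unity m (- l)) \<and> \<bar>h\<bar> \<le> 1}"
  proof clarify
    fix v v' assume v: "v \<in> V" "v' \<in> V" "\<bar>v - v'\<bar> \<le> 1"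
    obtain x y where xy: "x \<in> cap_seqs m B" "y \<in> cap_seqs m B"
      "v = Im (dft m x 1 * unity m (- l))" "v' = Im (dft m y 1 * unity m (- l))"
      using V v by meson
    have "v - v' = Im (dft m (\<lambda>j. x j - y j) 1 * unity m (- l))"
      by (simp add: xy(3,4) dft_diff left_diff_distrib algebra_simps)
    then show "\<exists>x\<in>cap_seqs m (B + B). v - v' = Im (dft m x 1 * unity m (- l)) \<and> \<bar>v - v'\<bar> \<le> 1"
      using cap_seqs_diff[OF xy(1,2)] v(3) by blast
  qed
  then have fin: "finite ?D" using finite_height_values[OF m] finite_subset by blast
  have eq: "{h. \<exists>z\<in>cap_set m. \<exists>z'\<in>cap_set m. h = Im ((z - z') * unity m (- l)) \<and> \<bar>h\<bar> \<le> L}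
      = {h \<in> V. \<bar>h\<bar> \<le> L}" for L
    unfolding V_def by blast
  show ?thesis
    by (rule that[of "real (card ?D)"])
      (use card_bounded_of_finite_differences[OF fin] in \<open>auto simp only: eq of_nat_0_le_iff\<close>)
qed

text \<open>The real sequence with transform \<open>z\<close> at \<open>1\<close>,
  \<open>cnj z\<close> at \<open>-1\<close> and \<open>0\<close> elsewhere is rounded down. Each of
  the \<open>m\<close> entries moves by at most \<open>1\<close>, hence every frequency by at most
  \<open>m\<close>.\<close>

lemma cap_set_relatively_dense:
  assumes m: "m \<ge> 3"
  shows "\<exists>s\<in>cap_set m. norm (z - s) \<le> of_int m"
proof -
  \<comment> \<open>In the inverse transform the terms of the frequencies \<open>1\<close> and
    \<open>-1\<close> are conjugate and add up to twice a real part.\<close>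
  define u where "u j = 2 / of_int m * Re (z * unity m (- j))" for j
  define x where "x j = \<lfloor>u j\<rfloor>" for j
  have u: "complex_of_real (u j) = (z * unity m (- j) + cnj z * unity m j) / of_int m" for j
    using complex_add_cnj[of "z * unity m (- j)"] by (simp add: u_def cnj_unity mult_ac)
  have peru: "u (j mod m) = u j" for j
    using unity_mod[of m j "-1"] m by (simp add: u_def)
  have per: "periodic m x" by (simp add: periodic_def x_def peru)
  have near: "norm ((\<Sum>j\<in>{0..<m}. of_real (u j) * unity m (j * k)) - dft m x k) \<le> of_int m" for k
  proof -
    have "(\<Sum>j\<in>{0..<m}. of_real (u j) * unity m (j * k)) - dft m x k
        = (\<Sum>j\<in>{0..<m}. of_real (u j - of_int (x j)) * unity m (j * k))"
      by (simp add: dft_def sum_subtractf left_diff_distrib)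
    also have "norm \<dots> \<le> (\<Sum>j\<in>{0..<m}. 1)"
    proof (rule sum_norm_le)
      fix j
      have "\<bar>u j - of_int (x j)\<bar> \<le> 1" unfolding x_def by linarith
      then show "norm (of_real (u j - of_int (x j)) * unity m (j * k)) \<le> 1"
        by (simp only: norm_mult norm_of_real norm_unity mult_1_right)
    qed
    finally show ?thesis using m by simp
  qed
  have trans: "(\<Sum>j\<in>{0..<m}. of_real (u j) * unity m (j * k))
      = (if m dvd k - 1 then z else 0) + (if m dvd k + 1 then cnj z else 0)" for k
  proof -
    have "(\<Sum>j\<in>{0..<m}. of_real (u j) * unity m (j * k))
        = (\<Sum>j\<in>{0..<m}. z / of_int m * unity m (j * (k - 1)) + cnj z / of_int m * unity m (j * (k + 1)))"
    proof (rule sum.cong[OF refl])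
      fix j
      have "unity m (j * (k - 1)) = unity m (- j) * unity m (j * k)"
        "unity m (j * (k + 1)) = unity m j * unity m (j * k)"
        by (simp_all add: algebra_simps flip: unity_add)
      then show "of_real (u j) * unity m (j * k)
          = z / of_int m * unity m (j * (k - 1)) + cnj z / of_int m * unity m (j * (k + 1))"
        by (simp add: u add_divide_distrib algebra_simps)
    qed
    also have "\<dots> = z / of_int m * (\<Sum>j\<in>{0..<m}. unity m (j * (k - 1)))
        + cnj z / of_int m * (\<Sum>j\<in>{0..<m}. unity m (j * (k + 1)))"
      by (simp only: sum.distrib sum_distrib_left)
    finally show ?thesis using m by (simp add: sum_unity)
  qed
  have "x \<in> cap_seqs m (of_int m)"
  proof -
    have "norm (dft m x k) \<le> of_int m" if "\<not> m dvd k - 1" "\<not> m dvd k + 1" for k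
      using near[of k] that by (simp add: trans)
    then show ?thesis using per by (simp add: cap_seqs_def)
  qed
  \<comment> \<open>If \<open>m\<close> divided \<open>2\<close>, the frequencies \<open>1\<close>
    and \<open>-1\<close> would coincide and the transform at \<open>1\<close> would approximate
    \<open>z + cnj z\<close>.\<close>
  moreover have "\<not> m dvd 2" using m by (auto dest: zdvd_imp_le)
  then have "norm (z - dft m x 1) \<le> of_int m"
    using near[of 1, unfolded trans] by simp
  ultimately show ?thesis unfolding cap_set_def by blast
qed

text \<open>The assumption \<open>cover\<close> makes every distance a multiple of a height from
  finitely many families, whose linear counts add up. Density carries over because \<open>T\<close>
  is Lipschitz from the modulus to \<open>nX\<close>.\<close>

lemma cap_set_distances:
  fixes nX :: "'a::real_vector \<Rightarrow> real" and T :: "complex \<Rightarrow> 'a"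
  assumes nX: "is_norm nX" and T: "linear T" "surj T" and m: "m \<ge> 3" and I: "finite I"
    and cover: "\<And>w. \<exists>(c, l)\<in>I. nX (T w) = c * Im (w * unity m (- l))"
  shows "well_distributed nX (T ` cap_set m)"
    and "finite (distance_set nX N (T ` cap_set m))"
    and "(\<lambda>N. real (card (distance_set nX N (T ` cap_set m)))) \<in> O(\<lambda>N. real N)"
proof -
  have tri: "nX (x + y) \<le> nX x + nX y" and scale: "nX (c *\<^sub>R x) = \<bar>c\<bar> * nX x"
    and nonneg: "nX x \<ge> 0" for x y c
    using nX by (auto simp: is_norm_def)
  interpret T: linear T by fact
  have bound: "nX (T w) \<le> norm w * (nX (T 1) + nX (T \<i>))" for w
  proof -
    have "w = Re w *\<^sub>R 1 + Im w *\<^sub>R \<i>" by (simp add: complex_eq_iff)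
    then have "T w = T (Re w *\<^sub>R 1 + Im w *\<^sub>R \<i>)" by (rule arg_cong)
    also have "\<dots> = Re w *\<^sub>R T 1 + Im w *\<^sub>R T \<i>" by (simp only: T.add T.scale)
    finally have "T w = Re w *\<^sub>R T 1 + Im w *\<^sub>R T \<i>" .
    then have "nX (T w) \<le> \<bar>Re w\<bar> * nX (T 1) + \<bar>Im w\<bar> * nX (T \<i>)"
      using tri[of "Re w *\<^sub>R T 1" "Im w *\<^sub>R T \<i>"] by (simp only: scale)
    also have "\<dots> \<le> norm w * nX (T 1) + norm w * nX (T \<i>)"
      by (intro add_mono mult_right_mono nonneg abs_Re_le_cmod abs_Im_le_cmod)
    finally show ?thesis by (simp add: distrib_left)
  qed
  show "well_distributed nX (T ` cap_set m)"
    unfolding well_distributed_def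
  proof (intro exI allI)
    fix x
    obtain z where x: "x = T z" using T(2) by blast
    obtain s where s: "s \<in> cap_set m" "norm (z - s) \<le> of_int m"
      using cap_set_relatively_dense[OF m] by blast
    have "nX (x - T s) \<le> norm (z - s) * (nX (T 1) + nX (T \<i>))"
      using bound[of "z - s"] by (simp add: x T.diff)
    also have "\<dots> \<le> of_int m * (nX (T 1) + nX (T \<i>))"
      using s(2) by (intro mult_right_mono add_nonneg_nonneg nonneg)
    finally show "\<exists>y\<in>T ` cap_set m. nX (x - y) \<le> of_int m * (nX (T 1) + nX (T \<i>))"
      using s(1) by blast
  qed
  define H where "H l L = {h. \<exists>z\<in>cap_set m. \<exists>z'\<in>cap_set m.
    h = Im ((z - z') * unity m (- l)) \<and> \<bar>h\<bar> \<le> L}" for l L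
  have "\<exists>D\<ge>0. \<forall>L\<ge>0. finite (H l L) \<and> real (card (H l L)) \<le> D * (2 * L + 2)" for l
  proof -
    have "m > 0" using m by simp
    then obtain D where "D \<ge> 0" "\<And>L. L \<ge> 0 \<Longrightarrow> finite (H l L)"
      "\<And>L. L \<ge> 0 \<Longrightarrow> real (card (H l L)) \<le> D * (2 * L + 2)"
      unfolding H_def by (rule cap_set_heights[of m l]) blast
    then show ?thesis by blast
  qed
  then obtain D where D0: "\<And>l. D l \<ge> 0" and finH: "\<And>l L. L \<ge> 0 \<Longrightarrow> finite (H l L)"
    and cardH: "\<And>l L. L \<ge> 0 \<Longrightarrow> real (card (H l L)) \<le> D l * (2 * L + 2)"
    by metis
  define G where "G N = (\<Union>(c, l)\<in>I. (*) c ` H l (real N / \<bar>c\<bar>))" for N :: nat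
  have finG: "finite (G N)" for N
    unfolding G_def using I by (auto intro!: finH)
  have sub: "distance_set nX N (T ` cap_set m) \<subseteq> G N" for N
  proof
    fix d assume "d \<in> distance_set nX N (T ` cap_set m)"
    then obtain z z' where z: "z \<in> cap_set m" "z' \<in> cap_set m"
      and d: "d = nX (T (z - z'))" "d \<le> real N"
      unfolding distance_set_def by (auto simp: T.diff)
    obtain c l where cl: "(c, l) \<in> I" "d = c * Im ((z - z') * unity m (- l))"
      using cover[of "z - z'"] d(1) by blast
    have "d \<in> (*) c ` H l (real N / \<bar>c\<bar>)"
    proof (cases "c = 0")
      case True
      \<comment> \<open>Division by zero makes the level \<open>0\<close>, and the difference of
        \<open>z\<close> with itself supplies the height \<open>0\<close>.\<close>
      have "0 \<in> H l 0" unfolding H_def using z(1) by (auto intro!: bexI[of _ z])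
      then show ?thesis using True cl(2) by auto
    next
      case False
      have "\<bar>c\<bar> * \<bar>Im ((z - z') * unity m (- l))\<bar> \<le> real N"
        using d nonneg[of "T (z - z')"] cl(2) by (simp only: abs_mult[symmetric])
      then have "\<bar>Im ((z - z') * unity m (- l))\<bar> \<le> real N / \<bar>c\<bar>"
        using False by (simp only: pos_le_divide_eq zero_less_abs_iff mult.commute not_False_eq_True)
      then show ?thesis using z cl(2) unfolding H_def by blast
    qed
    then show "d \<in> G N" using cl(1) unfolding G_def by blast
  qed
  show "finite (distance_set nX N (T ` cap_set m))"
    using finG sub by (rule rev_finite_subset)
  define C where "C = (\<Sum>(c, l)\<in>I. D l * (2 / \<bar>c\<bar> + 2))"
  have "real (card (distance_set nX N (T ` cap_set m))) \<le> C * real N" if N: "N \<ge> 1" for N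
  proof -
    have "card (distance_set nX N (T ` cap_set m)) \<le> card (G N)"
      using finG sub by (rule card_mono)
    also have "\<dots> \<le> (\<Sum>p\<in>I. card (case p of (c, l) \<Rightarrow> (*) c ` H l (real N / \<bar>c\<bar>)))"
      unfolding G_def by (rule card_UN_le[OF I])
    finally have "real (card (distance_set nX N (T ` cap_set m)))
        \<le> (\<Sum>p\<in>I. real (card (case p of (c, l) \<Rightarrow> (*) c ` H l (real N / \<bar>c\<bar>))))"
      unfolding of_nat_sum[symmetric] by (rule of_nat_mono)
    also have "\<dots> \<le> (\<Sum>(c, l)\<in>I. D l * (2 / \<bar>c\<bar> + 2) * real N)"
    proof (rule sum_mono, clarify)
      fix c l
      have "real (card ((*) c ` H l (real N / \<bar>c\<bar>))) \<le> real (card (H l (real N / \<bar>c\<bar>)))"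
        using card_image_le[OF finH[of "real N / \<bar>c\<bar>" l], of "(*) c"] by simp
      also have "\<dots> \<le> D l * (2 * (real N / \<bar>c\<bar>) + 2)" by (rule cardH) simp
      \<comment> \<open>\<open>N \<ge> 1\<close> turns the additive constant into a multiple of
        \<open>N\<close>.\<close>
      also have "\<dots> \<le> D l * (2 * (real N / \<bar>c\<bar>) + 2 * real N)"
        using N by (intro mult_left_mono[OF _ D0]) simp
      also have "\<dots> = D l * (2 / \<bar>c\<bar> + 2) * real N"
        by (simp only: distrib_left distrib_right mult.assoc times_divide_eq_left times_divide_eq_right)
      finally show "real (card ((*) c ` H l (real N / \<bar>c\<bar>))) \<le> D l * (2 / \<bar>c\<bar> + 2) * real N" .
    qed
    also have "\<dots> = C * real N"
      by (simp add: C_def sum_distrib_right case_prod_unfold)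
    finally show ?thesis .
  qed
  then show "(\<lambda>N. real (card (distance_set nX N (T ` cap_set m)))) \<in> O(\<lambda>N. real N)"
    by (intro bigoI[of _ C] eventually_sequentiallyI[of 1]) simp
qed

section \<open>Polygonal norms with rational angles\<close>

lemma rational_common_denominator:
  fixes Q :: "real set"
  assumes "finite Q" "Q \<subseteq> \<rat>"
  shows "\<exists>d>0::int. \<forall>q\<in>Q. \<exists>l::int. of_int d * q = of_int l"
  using assms
proof (induction Q rule: finite_induct)
  case empty
  then show ?case by (auto intro: exI[of _ 1])
next
  case (insert q Q)
  then obtain d where d: "d > 0" "\<And>q. q \<in> Q \<Longrightarrow> \<exists>l::int. of_int d * q = of_int l" by auto
  obtain a b :: int where b: "b > 0" "q = of_int a / of_int b"
    using insert.prems by (auto elim: Rats_cases')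
  have "\<exists>l::int. of_int (d * b) * q = of_int l"
    using b by (intro exI[of _ "d * a"]) simp
  moreover have "\<exists>l::int. of_int (d * b) * q' = of_int l" if q': "q' \<in> Q" for q'
  proof -
    obtain l :: int where "of_int d * q' = of_int l" using d(2)[OF q'] by blast
    then show ?thesis by (intro exI[of _ "b * l"]) (simp add: algebra_simps)
  qed
  ultimately show ?case
    using d(1) b(1) by (intro exI[of _ "d * b"]) auto
qed

text \<open>The normalised vector is not interior, and for a full-dimensional polytope the frontier
  is the union of the facets.\<close>

lemma norm_ball_facets:
  fixes nX :: "'a::euclidean_space \<Rightarrow> real"
  assumes nX: "is_norm nX" and P: "polytope (norm_unit_ball nX)"
    and dim: "aff_dim (norm_unit_ball nX) = DIM('a)" and x: "x \<noteq> 0"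
  obtains F where "F facet_of norm_unit_ball nX" "(1 / nX x) *\<^sub>R x \<in> F"
proof -
  let ?P = "norm_unit_ball nX" and ?y = "(1 / nX x) *\<^sub>R x"
  have scale: "nX (c *\<^sub>R x) = \<bar>c\<bar> * nX x" for c x using nX by (auto simp: is_norm_def)
  have pos: "nX x > 0" using nX x by (metis is_norm_def order_le_less)
  have y1: "nX ?y = 1" using pos by (simp add: scale)
  have "?y \<notin> interior ?P"
  proof
    assume "?y \<in> interior ?P"
    then obtain e where e: "e > 0" "cball ?y e \<subseteq> ?P" by (meson mem_interior_cball)
    \<comment> \<open>A radial displacement of Euclidean length \<open>e\<close> stays in the small
      ball but raises the norm to \<open>1 + t\<close>.\<close>
    define t where "t = e / norm ?y"
    have y0: "norm ?y > 0" using x pos by simp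
    have t: "t > 0" unfolding t_def using e(1) y0 by (rule divide_pos_pos)
    have "norm (t *\<^sub>R ?y) = e" using e x pos unfolding norm_scaleR t_def by simp
    then have "?y + t *\<^sub>R ?y \<in> cball ?y e" by (simp add: dist_norm)
    then have "?y + t *\<^sub>R ?y \<in> ?P" using e(2) by blast
    moreover have "?y + t *\<^sub>R ?y = (1 + t) *\<^sub>R ?y" by (simp only: scaleR_add_left scaleR_one)
    ultimately have "nX ((1 + t) *\<^sub>R ?y) \<le> 1" by (simp only: norm_unit_ball_def mem_Collect_eq)
    then show False using t unfolding scale[of "1 + t" ?y] y1 by simp
  qed
  moreover have "?y \<in> ?P" using y1 by (simp only: norm_unit_ball_def mem_Collect_eq)
  moreover have "rel_interior ?P = interior ?P"
    using dim by (simp add: aff_dim_eq_full rel_interior_interior)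
  ultimately have "?y \<in> rel_frontier ?P"
    using closure_subset unfolding rel_frontier_def by blast
  then show ?thesis
    using rel_frontier_of_polyhedron[OF polytope_imp_polyhedron[OF P]] that by blast
qed

text \<open>Central symmetry of the ball gives
  \<open>\<bar>n \<bullet> x\<bar> \<le> \<beta>\<close> on it, and \<open>\<beta> = 0\<close> would
  make the facet the whole ball.\<close>

lemma norm_ball_facet_normal:
  fixes nX :: "'a::euclidean_space \<Rightarrow> real"
  assumes nX: "is_norm nX" and P: "polytope (norm_unit_ball nX)"
    and F: "F facet_of norm_unit_ball nX"
  obtains n \<beta> where "\<beta> > 0" "\<And>x. x \<in> F \<Longrightarrow> n \<bullet> x = \<beta>"
proof -
  let ?P = "norm_unit_ball nX"
  obtain n \<beta> where n: "?P \<subseteq> {x. n \<bullet> x \<le> \<beta>}" "F = ?P \<inter> {x. n \<bullet> x = \<beta>}"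
    using facet_of_polyhedron[OF polytope_imp_polyhedron[OF P] F] by metis
  have neg: "- x \<in> ?P" if "x \<in> ?P" for x
    using nX that unfolding norm_unit_ball_def is_norm_def
    by (metis abs_minus_cancel abs_one mem_Collect_eq mult_1 scaleR_minus1_left)
  have abs: "\<bar>n \<bullet> x\<bar> \<le> \<beta>" if "x \<in> ?P" for x
    using n(1) that neg[OF that] by (auto simp: abs_le_iff)
  have "F \<noteq> {}" "F \<noteq> ?P" using F by (auto simp: facet_of_def)
  then have "\<beta> \<noteq> 0" "\<beta> \<ge> 0" using n(2) abs by fastforce+
  then show ?thesis using that[of \<beta> n] n(2) by auto
qed

text \<open>Links facets to the edges of the angle condition: a one-dimensional face of a polytope
  is compact, convex and collinear.\<close>

lemma polygon_facet_is_segment: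
  assumes P: "polytope P" "aff_dim P = 2" and F: "F facet_of P"
  obtains a b where "a \<noteq> b" "F = closed_segment a b" "closed_segment a b edge_of P"
proof -
  have F': "F face_of P" "F \<noteq> {}" "aff_dim F = 1" using F P(2) by (auto simp: facet_of_def)
  have "polytope F" using P(1) F'(1) by (rule face_of_polytope_polytope)
  then have "compact F" "convex F" by (rule polytope_imp_compact, rule polytope_imp_convex)
  moreover have "collinear F" using F'(3) by (simp add: collinear_aff_dim)
  ultimately obtain a b where ab: "F = closed_segment a b"
    using compact_convex_collinear_segment[OF F'(2)] by blast
  have "a \<noteq> b" using F'(3) ab by auto
  moreover have "closed_segment a b edge_of P" using F'(1,3) unfolding edge_of_def ab by blast
  ultimately show ?thesis using ab that by blast
qed

text \<open>Complex multiplication by \<open>u\<close>: the second vector is \<open>u\<close> turned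
  by a right angle. Euclidean lengths are scaled by \<open>norm u\<close>.\<close>

definition frame :: "real^2 \<Rightarrow> complex \<Rightarrow> real^2" where
  "frame u w = Re w *\<^sub>R u + Im w *\<^sub>R vector [- u $ 2, u $ 1]"

lemma linear_frame: "linear (frame u)"
  by (rule linearI) (simp_all add: frame_def algebra_simps)

text \<open>The preimage of \<open>x\<close> is the complex quotient of \<open>x\<close> by
  \<open>u\<close>: the product with the conjugate of \<open>u\<close>, divided by the squared
  length \<open>r\<close>.\<close>

lemma frame_surj:
  assumes "u \<noteq> 0"
  shows "surj (frame u)"
proof (rule surjI)
  fix x :: "real^2"
  define r where "r = (u $ 1)\<^sup>2 + (u $ 2)\<^sup>2"
  have "r \<noteq> 0"
    using assms unfolding r_def by (auto simp: vec_eq_iff forall_2 sum_power2_eq_zero_iff)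
  moreover have x: "(x $ 1 * u $ 1 + x $ 2 * u $ 2) * u $ 1 - (x $ 2 * u $ 1 - x $ 1 * u $ 2) * u $ 2 = x $ 1 * r"
    "(x $ 1 * u $ 1 + x $ 2 * u $ 2) * u $ 2 + (x $ 2 * u $ 1 - x $ 1 * u $ 2) * u $ 1 = x $ 2 * r"
    unfolding r_def power2_eq_square by (simp_all add: algebra_simps)
  ultimately show "frame u (Complex ((x $ 1 * u $ 1 + x $ 2 * u $ 2) / r) ((x $ 2 * u $ 1 - x $ 1 * u $ 2) / r)) = x"
    using x by (simp add: frame_def vec_eq_iff forall_2 flip: diff_divide_distrib add_divide_distrib)
qed

text \<open>As \<open>frame u\<close> is a similarity sending \<open>1\<close> to \<open>u\<close>,
  the angle between \<open>u\<close> and \<open>v\<close> is the angle between \<open>1\<close> and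
  the preimage of \<open>v\<close>.\<close>

lemma rational_angle_frame:
  assumes u: "u \<noteq> 0" and v: "v \<noteq> 0" and ang: "euclidean_angle u v = q * pi" and q: "q \<in> \<rat>"
  obtains q' t where "q' \<in> \<rat>" "t > 0" "v = t *\<^sub>R frame u (cis (q' * pi))"
proof -
  obtain w where w: "v = frame u w" using frame_surj[OF u] by blast
  have norm_sq: "(norm x)\<^sup>2 = (x $ 1)\<^sup>2 + (x $ 2)\<^sup>2" for x :: "real^2"
    unfolding power2_norm_eq_inner by (simp add: inner_vec_def sum_2 power2_eq_square)
  have "(norm v)\<^sup>2 = (norm w * norm u)\<^sup>2"
    by (simp add: norm_sq w frame_def power_mult_distrib cmod_power2) (simp add: algebra_simps power2_eq_square)
  then have nv: "norm v = norm w * norm u" by (rule power2_eq_imp_eq) simp_all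
  have inner: "u \<bullet> v = Re w * (norm u)\<^sup>2"
    by (simp add: norm_sq w frame_def inner_vec_def sum_2) (simp add: algebra_simps power2_eq_square)
  have w0: "norm w > 0" using v nv by auto
  have quot: "(u \<bullet> v) / (norm u * norm v) = Re w / norm w"
    using u w0 unfolding inner nv by (simp add: field_simps power2_eq_square)
  have "cos (q * pi) = Re w / norm w"
  proof -
    have "\<bar>Re w / norm w\<bar> \<le> 1" using abs_Re_le_cmod[of w] w0 by simp
    moreover have "q * pi = arccos (Re w / norm w)"
      using ang quot by (simp only: euclidean_angle_def)
    ultimately show ?thesis by (simp only: cos_arccos_abs)
  qed
  then have Re: "Re w = norm w * cos (q * pi)" using w0 by simp
  have "(Im w)\<^sup>2 = (norm w)\<^sup>2 - (Re w)\<^sup>2"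
    by (simp add: cmod_power2)
  also have "\<dots> = (norm w * sin (q * pi))\<^sup>2"
    unfolding Re by (simp add: power_mult_distrib sin_squared_eq right_diff_distrib)
  finally have "(Im w)\<^sup>2 = (norm w * sin (q * pi))\<^sup>2" .
  \<comment> \<open>An unoriented angle fixes the argument only up to sign; \<open>q'\<close>
    absorbs the sign.\<close>
  then have "Im w = norm w * sin (q * pi) \<or> Im w = norm w * sin (- q * pi)"
    by (simp add: power2_eq_iff)
  then obtain q' where q': "q' = q \<or> q' = - q" "Im w = norm w * sin (q' * pi)" by blast
  have "cos (q' * pi) = cos (q * pi)"
    using q'(1) by auto
  then have "w = norm w *\<^sub>R cis (q' * pi)"
    by (intro complex_eqI) (simp_all only: scaleR_complex.sel cis.sel Re q'(2))
  then have "v = norm w *\<^sub>R frame u (cis (q' * pi))"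
    unfolding w by (subst linear_scale[OF linear_frame, symmetric]) (rule arg_cong)
  moreover have "q' \<in> \<rat>" using q' q by auto
  ultimately show ?thesis using w0 by (intro that)
qed

text \<open>In the basis \<open>cis \<phi>\<close>, \<open>\<i> * cis \<phi>\<close> the coordinates
  of \<open>w\<close> are the real and imaginary parts of \<open>w * cis (- \<phi>)\<close>, and
  only the second contributes.\<close>

lemma linear_functional_vanishing_at_cis:
  fixes g :: "complex \<Rightarrow> real"
  assumes "linear g" "g (cis \<phi>) = 0"
  shows "g w = g (\<i> * cis \<phi>) * Im (w * cis (- \<phi>))"
proof -
  interpret linear g by fact
  let ?z = "w * cis (- \<phi>)"
  have "w = ?z * cis \<phi>"
    by (simp add: mult.assoc cis_mult)
  also have "\<dots> = Re ?z *\<^sub>R cis \<phi> + Im ?z *\<^sub>R (\<i> * cis \<phi>)"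
    by (subst complex_eq[of ?z]) (simp add: scaleR_conv_of_real algebra_simps)
  finally have "g w = g (Re ?z *\<^sub>R cis \<phi> + Im ?z *\<^sub>R (\<i> * cis \<phi>))" by (rule arg_cong)
  also have "\<dots> = g (\<i> * cis \<phi>) * Im ?z" by (simp only: add scale assms(2)) simp
  finally show ?thesis .
qed

theorem corollary1:
  fixes nX :: "real^2 \<Rightarrow> real"
  assumes "is_norm nX"
    and "convex_polygon (norm_unit_ball nX)"
    and "rational_side_angles (norm_unit_ball nX)"
  shows "\<exists>S. well_distributed nX S \<and>
           (\<forall>N\<ge>1. finite (distance_set nX N S)) \<and>
           (\<lambda>N. real (card (distance_set nX N S))) \<in> O(\<lambda>N. real N)"
proof -
  define P where "P = norm_unit_ball nX"
  have P: "polytope P" "aff_dim P = 2"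
    using assms(2) unfolding P_def convex_polygon_def by blast+
  have facet: "\<exists>F. F facet_of P \<and> (1 / nX x) *\<^sub>R x \<in> F" if x: "x \<noteq> 0" for x
  proof -
    have "aff_dim (norm_unit_ball nX) = DIM(real^2)" using P(2) by (simp add: P_def)
    then obtain F where "F facet_of norm_unit_ball nX" "(1 / nX x) *\<^sub>R x \<in> F"
      using x by (rule norm_ball_facets[OF assms(1) P(1)[unfolded P_def]])
    then show ?thesis unfolding P_def by blast
  qed
  obtain F0 where F0: "F0 facet_of P" using facet[of "axis 1 1"] by (metis axis_eq_0_iff zero_neq_one)
  obtain a0 b0 where ab0: "a0 \<noteq> b0" "closed_segment a0 b0 edge_of P"
    using P F0 by (rule polygon_facet_is_segment)
  define T where "T = frame (b0 - a0)"
  have T: "linear T" "surj T"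
    using ab0(1) unfolding T_def by (simp_all only: linear_frame frame_surj right_minus_eq not_sym not_False_eq_True)
  \<comment> \<open>On the cone over a side the norm is a linear functional that vanishes in the
    direction of the side, hence a multiple of the height above that direction.\<close>
  have "\<exists>c q. q \<in> \<rat> \<and> (\<forall>w. (1 / nX (T w)) *\<^sub>R T w \<in> F \<longrightarrow> nX (T w) = c * Im (w * cis (- (q * pi))))"
    if F: "F facet_of P" for F
  proof -
    obtain a b where ab: "a \<noteq> b" "F = closed_segment a b" "closed_segment a b edge_of P"
      using P F by (rule polygon_facet_is_segment)
    obtain n \<beta> where n: "\<beta> > 0" "\<And>x. x \<in> F \<Longrightarrow> n \<bullet> x = \<beta>"
      using norm_ball_facet_normal[OF assms(1) P(1)[unfolded P_def] F[unfolded P_def]] by blast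
    obtain q where "q \<in> \<rat>" "euclidean_angle (b0 - a0) (b - a) = q * pi"
      using assms(3) ab0(2) ab(3) unfolding rational_side_angles_def P_def by blast
    then obtain q t where q: "q \<in> \<rat>" "t > 0" "b - a = t *\<^sub>R T (cis (q * pi))"
      using rational_angle_frame[of "b0 - a0" "b - a"] ab(1) ab0(1) unfolding T_def by auto
    have "n \<bullet> (b - a) = 0" using n(2)[of a] n(2)[of b] ab(2) by (simp add: inner_diff_right)
    then have 0: "n \<bullet> T (cis (q * pi)) = 0" using q by simp
    have "linear (\<lambda>w. n \<bullet> T w)"
      using linear_compose[OF T(1) bounded_linear.linear[OF bounded_linear_inner_right[of n]]]
      by (simp add: o_def)
    note lin = linear_functional_vanishing_at_cis[OF this 0]
    define c where "c = n \<bullet> T (\<i> * cis (q * pi)) / \<beta>"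
    have "nX (T w) = c * Im (w * cis (- (q * pi)))" if w: "(1 / nX (T w)) *\<^sub>R T w \<in> F" for w
    proof -
      have "(n \<bullet> T w) / nX (T w) = \<beta>" using n(2)[OF w] by simp
      \<comment> \<open>Positivity of \<open>\<beta>\<close> excludes \<open>nX (T w) = 0\<close>,
        for which the quotient would be \<open>0\<close>.\<close>
      then have "nX (T w) = (n \<bullet> T w) / \<beta>" using n(1) by (auto simp: field_simps)
      then show ?thesis by (simp add: lin[of w] c_def)
    qed
    then show ?thesis using q(1) by blast
  qed
  then obtain c q where cq: "\<And>F. F facet_of P \<Longrightarrow> q F \<in> \<rat>"
    "\<And>F w. F facet_of P \<Longrightarrow> (1 / nX (T w)) *\<^sub>R T w \<in> F \<Longrightarrow> nX (T w) = c F * Im (w * cis (- (q F * pi)))"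
    by metis
  have fin: "finite {F. F facet_of P}"
    using P(1) by (simp add: finite_polytope_facets)
  obtain d :: int where d: "d > 0" "\<And>F. F facet_of P \<Longrightarrow> \<exists>l::int. of_int d * q F = of_int l"
    using rational_common_denominator[of "q ` {F. F facet_of P}"] fin cq(1) by auto
  then obtain l where l: "\<And>F. F facet_of P \<Longrightarrow> of_int d * q F = of_int (l F)" by metis
  \<comment> \<open>The angle \<open>q F * pi\<close> equals \<open>2 * pi * (2 * l F) / m\<close>;
    the factor \<open>4\<close> ensures \<open>m \<ge> 3\<close> even for
    \<open>d = 1\<close>.\<close>
  define m where "m = 4 * d"
  \<comment> \<open>The pair \<open>(0, 0)\<close> serves the case \<open>T w = 0\<close>, which
    cannot be normalised onto a facet.\<close>
  define I where "I = insert (0, 0) ((\<lambda>F. (c F, 2 * l F)) ` {F. F facet_of P})"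
  have cis: "cis (- (q F * pi)) = unity m (- (2 * l F))" if "F facet_of P" for F
  proof -
    have qF: "q F = of_int (l F) / of_int d" using l[OF that] d(1) by (simp add: field_simps)
    show ?thesis unfolding qF using d(1) by (simp add: unity_def m_def field_simps)
  qed
  have cover: "\<exists>(c, l)\<in>I. nX (T w) = c * Im (w * unity m (- l))" for w
  proof (cases "T w = 0")
    case True
    then show ?thesis using assms(1) by (auto simp: I_def is_norm_def)
  next
    case False
    then obtain F where F: "F facet_of P" "(1 / nX (T w)) *\<^sub>R T w \<in> F" using facet by blast
    then show ?thesis using cq(2)[OF F] cis[OF F(1)] by (auto simp: I_def)
  qed
  have "m \<ge> 3" "finite I" using d(1) fin by (auto simp: m_def I_def)
  from cap_set_distances[OF assms(1) T this cover] show ?thesis by blast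
qed

end
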